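(* Let $C$, $X$, $Z$, $\mu_0'$, $\mu_1'$, the set $\mathcal D$ and the MAP adversary's accuracy $\Pr(\hat C=C)$ be as defined in the context. After solving for the optimal parameters $$(\beta_0^*,\beta_1^* )=\operatorname*{arg\,min}_{(\beta_0,\beta_1)\in\mathcal D}\Pr(\hat C=C),$$ the adversary's accuracy is $$\Pr{}^*(\hat C=C)=\tilde p\,Q\!\Big(-\frac{\sigma}{\mu_0'-\mu_1'}\log\frac{1-\tilde p}{\tilde p}+\frac{\mu_0'-\mu_1'}{2\sigma}\Big)+(1-\tilde p)\,Q\!\Big(\frac{\sigma}{\mu_0'-\mu_1'}\log\frac{1-\tilde p}{\tilde p}+\frac{\mu_0'-\mu_1'}{2\sigma}\Big),$$ where $\mu_0'=\mu_0+\beta_0^*$, $\mu_1'=\mu_1-\beta_1^*$, and the solutions $\beta_0^*,\beta_1^*$ are given by $$\beta_0^*=\sqrt{\frac{\tilde p}{1-\tilde p}D},\quad \beta_1^*=\sqrt{\frac{1-\tilde p}{\tilde p}D}\qquad\text{if } D\le\tilde p(1-\tilde p)(\mu_1-\mu_0)^2,$$ and by $$\beta_0^*=(\mu_1-\mu_0)(1-\tilde p),\quad \beta_1^*=(\mu_1-\mu_0)\tilde p\qquad\text{otherwise.}$$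
   Context: Let $\mu_0\le\mu_1$ be real numbers, $\sigma>0$, $\tilde p\in(0,1)$, $D\ge0$. $C\in\{0,1\}$ is a private label with $P(C=0)=\tilde p$, $P(C=1)=1-\tilde p$. Given $C=0$, $X\sim\mathcal N(\mu_0,\sigma^2)$; given $C=1$, $X\sim\mathcal N(\mu_1,\sigma^2)$. For parameters $\beta_0,\beta_1\ge 0$ the disclosed variable is $Z=X+(1-C)\beta_0-C\beta_1$, so that $Z\mid C=0\sim\mathcal N(\mu_0',\sigma^2)$ and $Z\mid C=1\sim\mathcal N(\mu_1',\sigma^2)$ with $\mu_0'=\mu_0+\beta_0$, $\mu_1'=\mu_1-\beta_1$; the parameters are required to satisfy $\mu_0'\le\mu_1'$ throughout. The distortion set is $$\mathcal D=\{(\beta_0,\beta_1):\ (1-\tilde p)\beta_0^2+\tilde p\,\beta_1^2\le D,\ \beta_0\ge 0,\ \beta_1\ge 0\}.$$ The MAP adversary knows the distribution of $Z$, observes $Z$, and outputs a guess $\hat C$ of $C$ of maximal posterior probability; $\Pr(\hat C=C)$ is its accuracy. $Q(x)=\frac1{\sqrt{2\pi}}\int_x^\infty e^{-u^2/2}\,du$, and $\log$ is the natural logarithm.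
   Formalization: Second case: the printed pair can lie outside 𝒟 (p̃=1/10, μ₁−μ₀=1, D=1/5); proved for ((μ₁−μ₀)p̃,(μ₁−μ₀)(1−p̃)), a minimiser not claimed unique; the printed pair is optimal iff it is in 𝒟. At μ₀'=μ₁' the accuracy formula, undefined there, is read as its limit as μ₀'−μ₁'→0⁻. *)

theory Defs
  imports "HOL-Probability.Probability"
begin

definition gaussian_Q :: "real \<Rightarrow> real" where
  "gaussian_Q x = 1 / sqrt (2 * pi) * (LINT u:{x..}|lborel. exp (- u\<^sup>2 / 2))"

definition disclosed ::
  "('a \<Rightarrow> nat) \<Rightarrow> ('a \<Rightarrow> real) \<Rightarrow> real \<Rightarrow> real \<Rightarrow> 'a \<Rightarrow> real" where
  "disclosed C X b0 b1 \<omega> = X \<omega> + (1 - real (C \<omega>)) * b0 - real (C \<omega>) * b1"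

definition distortion_set :: "real \<Rightarrow> real \<Rightarrow> (real \<times> real) set" where
  "distortion_set p D =
     {(b0, b1). (1 - p) * b0\<^sup>2 + p * b1\<^sup>2 \<le> D \<and> b0 \<ge> 0 \<and> b1 \<ge> 0}"

text \<open>The order of the two means is a constraint on the parameters in addition to the
  distortion bound; the optimisation is over the pairs satisfying both.\<close>

definition admissible :: "real \<Rightarrow> real \<Rightarrow> real \<Rightarrow> real \<Rightarrow> (real \<times> real) set" where
  "admissible \<mu>0 \<mu>1 p D = {(b0, b1) \<in> distortion_set p D. \<mu>0 + b0 \<le> \<mu>1 - b1}"

text \<open>A version of \<open>P(C = c | Z)\<close>, as a random variable.\<close>

definition posterior ::
  "'a measure \<Rightarrow> ('a \<Rightarrow> nat) \<Rightarrow> ('a \<Rightarrow> real) \<Rightarrow> nat \<Rightarrow> 'a \<Rightarrow> real" where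
  "posterior M C Z c =
     real_cond_exp M (vimage_algebra (space M) Z borel) (indicator {\<omega> \<in> space M. C \<omega> = c})"

text \<open>A decision rule \<open>g\<close> yields the guess \<open>g (Z \<omega>)\<close>. Ties may be broken arbitrarily, and
  since posteriors are only determined almost surely, so is the optimality requirement.\<close>

definition MAP_rule ::
  "'a measure \<Rightarrow> ('a \<Rightarrow> nat) \<Rightarrow> ('a \<Rightarrow> real) \<Rightarrow> (real \<Rightarrow> nat) \<Rightarrow> bool" where
  "MAP_rule M C Z g \<longleftrightarrow>
     g \<in> borel \<rightarrow>\<^sub>M count_space {0, 1} \<and>
     (AE \<omega> in M. \<forall>c\<in>{0, 1}. posterior M C Z c \<omega> \<le> posterior M C Z (g (Z \<omega>)) \<omega>)"

definition accuracy ::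
  "'a measure \<Rightarrow> ('a \<Rightarrow> nat) \<Rightarrow> ('a \<Rightarrow> real) \<Rightarrow> (real \<Rightarrow> nat) \<Rightarrow> real" where
  "accuracy M C Z g = measure M {\<omega> \<in> space M. g (Z \<omega>) = C \<omega>}"

text \<open>The argument \<open>\<delta>\<close> stands for \<open>\<mu>0' - \<mu>1' \<le> 0\<close>. At \<open>\<delta> = 0\<close> the total division of HOL
  gives a value without meaning; there the formula is to be read as its limit for \<open>\<delta>\<close>
  tending to 0 from below.\<close>

definition accuracy_formula :: "real \<Rightarrow> real \<Rightarrow> real \<Rightarrow> real" where
  "accuracy_formula \<sigma> p \<delta> =
     p * gaussian_Q (- (\<sigma> / \<delta>) * ln ((1 - p) / p) + \<delta> / (2 * \<sigma>)) +
     (1 - p) * gaussian_Q ((\<sigma> / \<delta>) * ln ((1 - p) / p) + \<delta> / (2 * \<sigma>))"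

text \<open>For \<open>D > p (1 - p) (\<mu>1 - \<mu>0)\<^sup>2\<close>, the pair \<open>((\<mu>1 - \<mu>0) (1 - p), (\<mu>1 - \<mu>0) p)\<close> found in the
  source has distortion \<open>(p ^ 3 + (1 - p) ^ 3) (\<mu>1 - \<mu>0)\<^sup>2\<close>, which may exceed \<open>D\<close>
  (e.g. \<open>p = 1/10\<close>, \<open>\<mu>1 - \<mu>0 = 1\<close>, \<open>D = 1/5\<close>). It is optimal exactly when it lies in the
  distortion set. Exchanging the factors \<open>p\<close> and \<open>1 - p\<close> gives the pair continuing the
  solution for \<open>D \<le> p (1 - p) (\<mu>1 - \<mu>0)\<^sup>2\<close>, which is always optimal. The minimiser is in
  general not unique for these \<open>D\<close>.\<close>

definition small_D_solution :: "real \<Rightarrow> real \<Rightarrow> real \<times> real" where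
  "small_D_solution p D = (sqrt (p / (1 - p) * D), sqrt ((1 - p) / p * D))"

definition large_D_solution :: "real \<Rightarrow> real \<Rightarrow> real \<Rightarrow> real \<times> real" where
  "large_D_solution \<mu>0 \<mu>1 p = ((\<mu>1 - \<mu>0) * p, (\<mu>1 - \<mu>0) * (1 - p))"

definition large_D_solution_source :: "real \<Rightarrow> real \<Rightarrow> real \<Rightarrow> real \<times> real" where
  "large_D_solution_source \<mu>0 \<mu>1 p = ((\<mu>1 - \<mu>0) * (1 - p), (\<mu>1 - \<mu>0) * p)"

end

theory Submission imports Defs begin

text \<open>A MAP rule maximises the accuracy among all decision rules, because the accuracy of \<open>h\<close> is the
  expectation of the posterior of \<open>h (Z)\<close>. As the likelihood ratio of the two Gaussians is
  monotone, its accuracy is therefore that of a threshold rule, and it depends on the parameters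
  only through the gap \<open>\<mu>1' - \<mu>0' = (\<mu>1 - \<mu>0) - (b0 + b1)\<close>. Widening the gap with the threshold
  and \<open>\<mu>0'\<close> kept fixed already improves a threshold rule, so the accuracy is strictly increasing
  in the gap, without any computation of derivatives. It remains to maximise \<open>b0 + b1\<close> over the
  admissible pairs, which is the Cauchy-Schwarz inequality.\<close>

section \<open>Gaussian probabilities of half-lines and the function
  \<open>gaussian_Q\<close>\<close>

abbreviation normal_dist :: "real \<Rightarrow> real \<Rightarrow> real measure" where
  "normal_dist m \<sigma> \<equiv> density lborel (\<lambda>x. ennreal (normal_density m \<sigma> x))"

lemma measure_normal_dist:
  assumes "\<sigma> > 0" "S \<in> sets borel"
  shows "measure (normal_dist m \<sigma>) S = (\<integral>x. indicator S x * normal_density m \<sigma> x \<partial>lborel)"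
proof -
  have "measure (normal_dist m \<sigma>) S = (\<integral>x. indicator S x \<partial>normal_dist m \<sigma>)"
    using assms by simp
  also have "\<dots> = (\<integral>x. normal_density m \<sigma> x * indicator S x \<partial>lborel)"
    using assms by (subst integral_real_density) auto
  finally show ?thesis by (simp add: mult.commute)
qed

lemma measure_normal_dist_singleton:
  assumes "\<sigma> > 0"
  shows "measure (normal_dist m \<sigma>) {x} = 0"
proof -
  have "AE y in lborel. y \<in> {x} \<longrightarrow> ennreal (normal_density m \<sigma> y) = 0"
    using AE_lborel_singleton[of x] by eventually_elim simp
  then have "{x} \<in> null_sets (normal_dist m \<sigma>)"
    by (subst null_sets_density_iff) (simp_all only: measurable_lborel1 sets_lborel, measurable)
  then show ?thesis by (simp add: measure_eq_0_null_sets)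
qed

text \<open>Through this identity, monotonicity, continuity and limits of \<open>gaussian_Q\<close>
  become facts about a probability distribution on the line.\<close>

lemma gaussian_Q_eq_measure: "gaussian_Q x = measure (normal_dist 0 1) {x..}"
  unfolding gaussian_Q_def set_lebesgue_integral_def
  by (subst measure_normal_dist)
     (auto simp: normal_density_def mult_ac simp flip: integral_mult_right_zero)

text \<open>A negative \<open>\<alpha>\<close> is allowed so that reflection can turn lower
  half-lines into upper ones; \<open>\<alpha> = 1\<close> gives the shift caused by
  disclosure.\<close>

lemma measure_normal_dist_affine:
  assumes "\<sigma> > 0" "\<alpha> \<noteq> 0" "S \<in> sets borel"
  shows "measure (normal_dist (\<beta> + \<alpha> * m) (\<bar>\<alpha>\<bar> * \<sigma>)) S =
    measure (normal_dist m \<sigma>) {x. \<beta> + \<alpha> * x \<in> S}"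
proof -
  interpret prob_space "normal_dist m \<sigma>" using assms by (simp add: prob_space_normal_density)
  \<comment> \<open>The identity on the line is a random variable with this law, so the affine rule
    for normal variables applies to it.\<close>
  have "distributed (normal_dist m \<sigma>) lborel (\<lambda>x. x) (normal_density m \<sigma>)"
    by (auto simp: distributed_def distr_id2)
  from normal_density_affine[OF this assms(1,2), of \<beta>]
  have *: "distr (normal_dist m \<sigma>) lborel (\<lambda>x. \<beta> + \<alpha> * x) = normal_dist (\<beta> + \<alpha> * m) (\<bar>\<alpha>\<bar> * \<sigma>)"
    by (rule distributed_distr_eq_density)
  have "measure (distr (normal_dist m \<sigma>) lborel (\<lambda>x. \<beta> + \<alpha> * x)) S =
      measure (normal_dist m \<sigma>) {x. \<beta> + \<alpha> * x \<in> S}"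
    using assms by (subst measure_distr) (auto simp: vimage_def)
  then show ?thesis unfolding * .
qed

lemma measure_normal_dist_atLeast:
  assumes "\<sigma> > 0"
  shows "measure (normal_dist m \<sigma>) {t..} = gaussian_Q ((t - m) / \<sigma>)"
proof -
  have "{x. m + \<sigma> * x \<in> {t..}} = {(t - m) / \<sigma>..}"
    using assms by (auto simp: field_simps)
  then show ?thesis
    using measure_normal_dist_affine[of 1 \<sigma> "{t..}" m 0] assms by (simp add: gaussian_Q_eq_measure)
qed

lemma measure_normal_dist_atMost:
  assumes "\<sigma> > 0"
  shows "measure (normal_dist m \<sigma>) {..t} = gaussian_Q ((m - t) / \<sigma>)"
proof -
  have "{x. m + (- \<sigma>) * x \<in> {..t}} = {(m - t) / \<sigma>..}"
    using assms by (auto simp: field_simps)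
  then show ?thesis
    using measure_normal_dist_affine[of 1 "- \<sigma>" "{..t}" m 0] assms by (simp add: gaussian_Q_eq_measure)
qed

lemma measure_normal_dist_greaterThan:
  assumes "\<sigma> > 0"
  shows "measure (normal_dist m \<sigma>) {t<..} = gaussian_Q ((t - m) / \<sigma>)"
proof -
  interpret prob_space "normal_dist m \<sigma>" using assms by (simp add: prob_space_normal_density)
  have "{t..} = {t} \<union> {t<..}" by auto
  then have "measure (normal_dist m \<sigma>) {t..} = 0 + measure (normal_dist m \<sigma>) {t<..}"
    using finite_measure_Union[of "{t}" "{t<..}"] measure_normal_dist_singleton[OF assms] by simp
  then show ?thesis using measure_normal_dist_atLeast[OF assms] by simp
qed

lemma gaussian_Q_minus: "gaussian_Q (- x) = 1 - gaussian_Q x"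
proof -
  interpret prob_space "normal_dist 0 1" by (simp add: prob_space_normal_density)
  have "- {..x} = {x<..}" by auto
  then show ?thesis
    using prob_compl[of "{..x}"] measure_normal_dist_atMost[of 1 0 x]
      measure_normal_dist_greaterThan[of 1 0 x] by (simp add: Compl_eq_Diff_UNIV)
qed

lemma gaussian_Q_eq_cdf: "gaussian_Q x = cdf (normal_dist 0 1) (- x)"
  using measure_normal_dist_atMost[of 1 0 "- x"] by (simp add: cdf_def)

text \<open>The density vanishes nowhere, so a Gaussian null set is also Lebesgue null, which an
  interval of positive length is not.\<close>

lemma gaussian_Q_strict_antimono:
  assumes "x < y"
  shows "gaussian_Q y < gaussian_Q x"
proof -
  interpret prob_space "normal_dist 0 1" by (simp add: prob_space_normal_density)
  have "{x..} = {x..<y} \<union> {y..}" using assms by auto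
  then have Q: "gaussian_Q x = measure (normal_dist 0 1) {x..<y} + gaussian_Q y"
    using finite_measure_Union[of "{x..<y}" "{y..}"]
    by (simp add: gaussian_Q_eq_measure ivl_disj_int)
  have "measure (normal_dist 0 1) {x..<y} \<noteq> 0"
  proof
    assume "measure (normal_dist 0 1) {x..<y} = 0"
    then have "{x..<y} \<in> null_sets (normal_dist 0 1)"
      by (auto simp: emeasure_eq_measure)
    then have "AE z in lborel. z \<in> {x..<y} \<longrightarrow> ennreal (normal_density 0 1 z) = 0"
      by (subst (asm) null_sets_density_iff) auto
    moreover have "ennreal (normal_density 0 1 z) \<noteq> 0" for z
      using normal_density_pos[of 1 0 z] by (simp add: ennreal_eq_0_iff not_le)
    ultimately have "AE z in lborel. z \<notin> {x..<y}" by simp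
    then have "{x..<y} \<in> null_sets lborel"
      by (subst (asm) AE_iff_null_sets[symmetric]) auto
    then show False using assms by (simp add: null_sets_def)
  qed
  then show ?thesis using Q measure_nonneg[of "normal_dist 0 1" "{x..<y}"] by linarith
qed

text \<open>A distribution function is continuous at every point without mass.\<close>

lemma isCont_gaussian_Q: "isCont gaussian_Q x"
proof -
  interpret prob_space "normal_dist 0 1" by (simp add: prob_space_normal_density)
  interpret real_distribution "normal_dist 0 1" by unfold_locales auto
  have "isCont (cdf (normal_dist 0 1)) y" for y
    using isCont_cdf measure_normal_dist_singleton[of 1 0 y] by simp
  then have "isCont (\<lambda>x. cdf (normal_dist 0 1) (- x)) x"
    by (rule isCont_o2[rotated]) (intro continuous_intros)
  then show ?thesis by (simp add: gaussian_Q_eq_cdf[abs_def])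
qed

lemma gaussian_Q_at_bot: "(gaussian_Q \<longlongrightarrow> 1) at_bot"
proof -
  interpret prob_space "normal_dist 0 1" by (simp add: prob_space_normal_density)
  interpret real_distribution "normal_dist 0 1" by unfold_locales auto
  show ?thesis
    unfolding gaussian_Q_eq_cdf[abs_def]
    by (rule filterlim_compose[OF cdf_lim_at_top_prob filterlim_uminus_at_top_at_bot])
qed

lemma gaussian_Q_at_top: "(gaussian_Q \<longlongrightarrow> 0) at_top"
proof -
  interpret prob_space "normal_dist 0 1" by (simp add: prob_space_normal_density)
  interpret real_distribution "normal_dist 0 1" by unfold_locales auto
  show ?thesis
    unfolding gaussian_Q_eq_cdf[abs_def]
    by (rule filterlim_compose[OF cdf_lim_at_bot filterlim_uminus_at_bot_at_top])
qed


section \<open>Posterior probabilities and optimality of MAP rules\<close>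

text \<open>Whether the guess is \<open>c\<close> depends on \<open>Z\<close> alone, so the
  indicator \<open>I c\<close> of this event can be pulled out of the conditional expectation given
  \<open>Z\<close>. In the mean, the label indicator \<open>J c\<close> may thus be replaced by the
  posterior of \<open>c\<close>.\<close>

lemma accuracy_eq_integral_posterior:
  assumes M: "prob_space M" and C [measurable]: "C \<in> M \<rightarrow>\<^sub>M count_space {0, 1}"
    and Z [measurable]: "Z \<in> borel_measurable M"
    and h [measurable]: "h \<in> borel \<rightarrow>\<^sub>M count_space {0, 1}"
  shows "integrable M (\<lambda>\<omega>. posterior M C Z (h (Z \<omega>)) \<omega>)"
    and "accuracy M C Z h = (\<integral>\<omega>. posterior M C Z (h (Z \<omega>)) \<omega> \<partial>M)"
proof -
  interpret prob_space M by fact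
  define F where "F = vimage_algebra (space M) Z borel"
  have "subalgebra M F"
    using sets_image_in_sets[OF refl Z] by (simp add: subalgebra_def F_def)
  then interpret finite_measure_subalgebra M F by unfold_locales
  have ZF [measurable]: "Z \<in> borel_measurable F"
    unfolding F_def by (rule measurable_vimage_algebra1) simp
  define I where "I c = (indicator {\<omega>. h (Z \<omega>) = c} :: 'a \<Rightarrow> real)" for c
  define J where "J c = (indicator {\<omega> \<in> space M. C \<omega> = c} :: 'a \<Rightarrow> real)" for c
  have C01: "C \<omega> \<in> {0, 1}" if "\<omega> \<in> space M" for \<omega>
    using measurable_space[OF C that] by simp
  have h01: "h x \<in> {0, 1}" for x using measurable_space[OF h, of x] by simp
  have I: "I c \<in> borel_measurable F" for c
  proof -
    have "(\<lambda>x. indicator {c} (h x) :: real) \<in> borel_measurable borel"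
      by (rule measurable_compose[OF h]) simp
    from measurable_compose[OF ZF this] show ?thesis
      unfolding I_def by (simp add: indicator_def)
  qed
  have J [measurable]: "J c \<in> borel_measurable M" for c
  proof -
    have "(\<lambda>\<omega>. indicator {c} (C \<omega>) :: real) \<in> borel_measurable M"
      by (rule measurable_compose[OF C]) simp
    then show ?thesis
      by (rule measurable_cong[THEN iffD1, rotated]) (simp add: J_def indicator_def)
  qed
  have IM [measurable]: "I c \<in> borel_measurable M" for c
    using I subalg by (rule measurable_from_subalg[rotated])
  have int: "integrable M (\<lambda>\<omega>. I c \<omega> * J c \<omega>)" for c
    by (rule integrable_const_bound[of _ 1]) (auto simp: I_def J_def indicator_def)
  have post: "posterior M C Z c = real_cond_exp M F (J c)" for c
    by (simp add: posterior_def F_def J_def)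
  \<comment> \<open>Exactly one of the two guess indicators is 1, which turns the random index of
    the posterior into a sum over fixed labels.\<close>
  have split: "posterior M C Z (h (Z \<omega>)) \<omega> =
      I 0 \<omega> * real_cond_exp M F (J 0) \<omega> + I 1 \<omega> * real_cond_exp M F (J 1) \<omega>" for \<omega>
    using h01[of "Z \<omega>"] by (auto simp: I_def post)
  show "integrable M (\<lambda>\<omega>. posterior M C Z (h (Z \<omega>)) \<omega>)"
    unfolding split using real_cond_exp_intg(1)[OF int I J] by simp
  have "accuracy M C Z h = (\<integral>\<omega>. indicator {\<omega> \<in> space M. h (Z \<omega>) = C \<omega>} \<omega> \<partial>M)"
    by (simp add: accuracy_def Int_def conj_commute)
  also have "\<dots> = (\<integral>\<omega>. I 0 \<omega> * J 0 \<omega> + I 1 \<omega> * J 1 \<omega> \<partial>M)"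
  proof (rule Bochner_Integration.integral_cong)
    fix \<omega> assume "\<omega> \<in> space M"
    then show "indicator {\<omega> \<in> space M. h (Z \<omega>) = C \<omega>} \<omega> = I 0 \<omega> * J 0 \<omega> + I 1 \<omega> * J 1 \<omega>"
      using C01[of \<omega>] h01[of "Z \<omega>"] by (auto simp: I_def J_def)
  qed simp
  also have "\<dots> = (\<integral>\<omega>. posterior M C Z (h (Z \<omega>)) \<omega> \<partial>M)"
    unfolding split using real_cond_exp_intg[OF int I J] int by simp
  finally show "accuracy M C Z h = (\<integral>\<omega>. posterior M C Z (h (Z \<omega>)) \<omega> \<partial>M)" .
qed

lemma MAP_rule_maximizes_accuracy:
  assumes "prob_space M" "C \<in> M \<rightarrow>\<^sub>M count_space {0, 1}" "Z \<in> borel_measurable M"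
    and g: "MAP_rule M C Z g" and h: "h \<in> borel \<rightarrow>\<^sub>M count_space {0, 1}"
  shows "accuracy M C Z h \<le> accuracy M C Z g"
proof -
  have g': "g \<in> borel \<rightarrow>\<^sub>M count_space {0, 1}"
    and *: "AE \<omega> in M. \<forall>c\<in>{0, 1}. posterior M C Z c \<omega> \<le> posterior M C Z (g (Z \<omega>)) \<omega>"
    using g by (auto simp: MAP_rule_def)
  have "AE \<omega> in M. posterior M C Z (h (Z \<omega>)) \<omega> \<le> posterior M C Z (g (Z \<omega>)) \<omega>"
    using *
  proof eventually_elim
    case (elim \<omega>)
    have "h (Z \<omega>) \<in> {0, 1}" using measurable_space[OF h, of "Z \<omega>"] by simp
    with elim show ?case by blast
  qed
  then show ?thesis
    using accuracy_eq_integral_posterior[OF assms(1-3)] g' h by (auto intro!: integral_mono_AE)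
qed

section \<open>Decision regions and the likelihood-ratio test\<close>

text \<open>\<open>S\<close> is the set of observations on which the label 0 is guessed.\<close>

definition region_accuracy :: "real \<Rightarrow> real \<Rightarrow> real \<Rightarrow> real \<Rightarrow> real set \<Rightarrow> real" where
  "region_accuracy \<sigma> p m0 m1 S =
     p * measure (normal_dist m0 \<sigma>) S + (1 - p) * measure (normal_dist m1 \<sigma>) (- S)"

text \<open>The accuracy is the integral of a function that at each \<open>x\<close> selects one of
  the two weighted densities, depending on membership in the region. The likelihood-ratio region
  selects the larger one at every point.\<close>

lemma region_accuracy_le_likelihood_ratio:
  assumes "\<sigma> > 0" "S \<in> sets borel"
  shows "region_accuracy \<sigma> p m0 m1 S \<le>
    region_accuracy \<sigma> p m0 m1 {x. (1 - p) * normal_density m1 \<sigma> x \<le> p * normal_density m0 \<sigma> x}"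
    (is "_ \<le> region_accuracy _ _ _ _ ?L")
proof -
  have L: "?L \<in> sets borel" by measurable
  define J where "J S x = p * (indicator S x * normal_density m0 \<sigma> x) +
    (1 - p) * (indicator (- S) x * normal_density m1 \<sigma> x)" for S x
  have int: "integrable lborel (\<lambda>x. indicator S x * normal_density m \<sigma> x)"
    if "S \<in> sets borel" for S m
    using integrable_mult_indicator[of S lborel "normal_density m \<sigma>"] that assms by simp
  have acc: "region_accuracy \<sigma> p m0 m1 S = (\<integral>x. J S x \<partial>lborel)" and intJ: "integrable lborel (J S)"
    if "S \<in> sets borel" for S
    using that assms int[of S] int[of "- S"]
    by (auto simp: region_accuracy_def J_def[abs_def] measure_normal_dist)
  show ?thesis
    unfolding acc[OF L] acc[OF assms(2)]
    by (rule integral_mono) (use intJ L assms(2) in \<open>auto simp: J_def indicator_def\<close>)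
qed

text \<open>As the variances agree, the quadratic terms of the two log-likelihoods cancel. What
  remains is affine in \<open>x\<close>, and \<open>m0 < m1\<close> fixes the direction of the
  inequality.\<close>

lemma likelihood_ratio_region_eq_atMost:
  assumes "\<sigma> > 0" "0 < p" "p < 1" "m0 < m1"
  shows "{x. (1 - p) * normal_density m1 \<sigma> x \<le> p * normal_density m0 \<sigma> x} =
    {..(m0 + m1) / 2 - \<sigma>\<^sup>2 * ln ((1 - p) / p) / (m1 - m0)}"
proof -
  have "(1 - p) * normal_density m1 \<sigma> x \<le> p * normal_density m0 \<sigma> x \<longleftrightarrow>
      x \<le> (m0 + m1) / 2 - \<sigma>\<^sup>2 * ln ((1 - p) / p) / (m1 - m0)" for x
  proof -
    have "(1 - p) * normal_density m1 \<sigma> x \<le> p * normal_density m0 \<sigma> x \<longleftrightarrow>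
        ln ((1 - p) * normal_density m1 \<sigma> x) \<le> ln (p * normal_density m0 \<sigma> x)"
      using assms normal_density_pos[of \<sigma>] by simp
    also have "\<dots> \<longleftrightarrow> ln (1 - p) - (x - m1)\<^sup>2 / (2 * \<sigma>\<^sup>2) \<le> ln p - (x - m0)\<^sup>2 / (2 * \<sigma>\<^sup>2)"
      using assms by (simp add: normal_density_def ln_mult ln_div)
    also have "\<dots> \<longleftrightarrow> ln ((1 - p) / p) \<le> (m1 - m0) * (m0 + m1 - 2 * x) / (2 * \<sigma>\<^sup>2)"
    proof -
      have "(m1 - m0) * (m0 + m1 - 2 * x) = (x - m1)\<^sup>2 - (x - m0)\<^sup>2"
        by (simp add: power2_eq_square algebra_simps)
      moreover have "ln ((1 - p) / p) = ln (1 - p) - ln p" using assms by (intro ln_divide_pos) auto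
      ultimately show ?thesis by (simp only: diff_divide_distrib) linarith
    qed
    also have "\<dots> \<longleftrightarrow> x \<le> (m0 + m1) / 2 - \<sigma>\<^sup>2 * ln ((1 - p) / p) / (m1 - m0)"
    proof -
      have "x \<le> (m0 + m1) / 2 - \<sigma>\<^sup>2 * ln ((1 - p) / p) / (m1 - m0) \<longleftrightarrow>
          \<sigma>\<^sup>2 * ln ((1 - p) / p) / (m1 - m0) \<le> (m0 + m1) / 2 - x" by auto
      also have "\<dots> \<longleftrightarrow> \<sigma>\<^sup>2 * ln ((1 - p) / p) \<le> ((m0 + m1) / 2 - x) * (m1 - m0)"
        using assms by (intro pos_divide_le_eq) simp
      also have "\<dots> \<longleftrightarrow> ln ((1 - p) / p) * (2 * \<sigma>\<^sup>2) \<le> (m1 - m0) * (m0 + m1 - 2 * x)"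
        by (simp add: field_simps)
      also have "\<dots> \<longleftrightarrow> ln ((1 - p) / p) \<le> (m1 - m0) * (m0 + m1 - 2 * x) / (2 * \<sigma>\<^sup>2)"
        using assms by (intro pos_le_divide_eq[symmetric]) simp
      finally show ?thesis by (rule sym)
    qed
    finally show ?thesis .
  qed
  then show ?thesis by auto
qed

lemma region_accuracy_atMost:
  assumes "\<sigma> > 0"
  shows "region_accuracy \<sigma> p m0 m1 {..t} =
    p * gaussian_Q ((m0 - t) / \<sigma>) + (1 - p) * gaussian_Q ((t - m1) / \<sigma>)"
proof -
  have "- {..t} = {t<..}" by auto
  then show ?thesis using assms
    by (simp add: region_accuracy_def measure_normal_dist_atMost measure_normal_dist_greaterThan)
qed

text \<open>The arguments of \<open>gaussian_Q\<close> in the formula are the signed distances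
  between the threshold and the two means, in units of \<open>\<sigma>\<close>.\<close>

lemma accuracy_formula_eq_region_accuracy:
  assumes "\<sigma> > 0" "m0 < m1"
  shows "accuracy_formula \<sigma> p (m0 - m1) =
    region_accuracy \<sigma> p m0 m1 {..(m0 + m1) / 2 - \<sigma>\<^sup>2 * ln ((1 - p) / p) / (m1 - m0)}"
proof -
  let ?L = "ln ((1 - p) / p)"
  let ?t = "(m0 + m1) / 2 - \<sigma>\<^sup>2 * ?L / (m1 - m0)"
  \<comment> \<open>After substituting \<open>m0 + d\<close> for \<open>m1\<close>, the denominators
    are \<open>d\<close> and \<open>\<sigma>\<close> up to sign and constants, and can be
    cleared.\<close>
  define d where "d = m1 - m0"
  have d: "d > 0" "m1 = m0 + d" using assms by (auto simp: d_def)
  have "(m0 - ?t) / \<sigma> = - (\<sigma> / (m0 - m1)) * ?L + (m0 - m1) / (2 * \<sigma>)"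
    using assms d(1) unfolding d(2) by (simp add: field_simps power2_eq_square)
  moreover have "(?t - m1) / \<sigma> = (\<sigma> / (m0 - m1)) * ?L + (m0 - m1) / (2 * \<sigma>)"
    using assms d(1) unfolding d(2) by (simp add: field_simps power2_eq_square)
  ultimately show ?thesis
    unfolding region_accuracy_atMost[OF assms(1)] accuracy_formula_def by simp
qed

lemma region_accuracy_le_accuracy_formula:
  assumes "\<sigma> > 0" "0 < p" "p < 1" "m0 < m1" "S \<in> sets borel"
  shows "region_accuracy \<sigma> p m0 m1 S \<le> accuracy_formula \<sigma> p (m0 - m1)"
  using region_accuracy_le_likelihood_ratio[OF assms(1,5), of p m0 m1]
  unfolding accuracy_formula_eq_region_accuracy[OF assms(1,4)]
    likelihood_ratio_region_eq_atMost[OF assms(1-4)] .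

section \<open>The best accuracy as a function of the gap\<close>

text \<open>With equal means the observation carries no information on the label, and the best rule
  is to guess the likelier one. In contrast, division by zero would make
  \<open>accuracy_formula\<close> return 1/2 at 0.\<close>

definition map_accuracy :: "real \<Rightarrow> real \<Rightarrow> real \<Rightarrow> real" where
  "map_accuracy \<sigma> p \<delta> = (if \<delta> = 0 then max p (1 - p) else accuracy_formula \<sigma> p \<delta>)"

lemma region_accuracy_UNIV: "region_accuracy \<sigma> p m0 m1 UNIV = p" if "\<sigma> > 0"
proof -
  interpret prob_space "normal_dist m0 \<sigma>" using that by (simp add: prob_space_normal_density)
  show ?thesis using prob_space by (simp add: region_accuracy_def)
qed

lemma region_accuracy_empty: "region_accuracy \<sigma> p m0 m1 {} = 1 - p" if "\<sigma> > 0"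
proof -
  interpret prob_space "normal_dist m1 \<sigma>" using that by (simp add: prob_space_normal_density)
  show ?thesis using prob_space by (simp add: region_accuracy_def)
qed

lemma region_accuracy_le_map_accuracy:
  assumes "\<sigma> > 0" "0 < p" "p < 1" "m0 \<le> m1" "S \<in> sets borel"
  shows "region_accuracy \<sigma> p m0 m1 S \<le> map_accuracy \<sigma> p (m0 - m1)"
proof (cases "m0 = m1")
  case True
  interpret prob_space "normal_dist m1 \<sigma>" using assms by (simp add: prob_space_normal_density)
  \<comment> \<open>Both labels now induce the same law, so the accuracy is a weighted mean of
    \<open>p\<close> and \<open>1 - p\<close>.\<close>
  have "region_accuracy \<sigma> p m0 m1 S = p * prob S + (1 - p) * (1 - prob S)"
    using prob_compl[of S] assms True by (simp add: region_accuracy_def Compl_eq_Diff_UNIV)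
  also have "\<dots> \<le> max p (1 - p) * prob S + max p (1 - p) * (1 - prob S)"
    using prob_le_1[of S] by (intro add_mono mult_right_mono) auto
  finally show ?thesis using True by (simp add: map_accuracy_def algebra_simps)
next
  case False
  then show ?thesis
    using region_accuracy_le_accuracy_formula[of \<sigma> p m0 m1 S] assms by (simp add: map_accuracy_def)
qed

lemma map_accuracy_attained:
  assumes "\<sigma> > 0" "m0 \<le> m1"
  obtains S where "S \<in> sets borel" "region_accuracy \<sigma> p m0 m1 S = map_accuracy \<sigma> p (m0 - m1)"
proof (cases "m0 = m1")
  case True
  show ?thesis
  proof (rule that)
    \<comment> \<open>The constant rule for the likelier label: 0 is guessed everywhere or
      nowhere.\<close>
    show "(if 1 - p \<le> p then UNIV else {}) \<in> sets borel" by simp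
    show "region_accuracy \<sigma> p m0 m1 (if 1 - p \<le> p then UNIV else {}) = map_accuracy \<sigma> p (m0 - m1)"
      using True assms by (simp add: map_accuracy_def region_accuracy_UNIV region_accuracy_empty)
  qed
next
  case False
  with assms show ?thesis
    by (intro that[of "{..(m0 + m1) / 2 - \<sigma>\<^sup>2 * ln ((1 - p) / p) / (m1 - m0)}"])
       (auto simp: map_accuracy_def accuracy_formula_eq_region_accuracy)
qed

lemma map_accuracy_strict_antimono_neg:
  assumes "\<sigma> > 0" "0 < p" "p < 1" "\<delta> < \<delta>'" "\<delta>' < 0"
  shows "map_accuracy \<sigma> p \<delta>' < map_accuracy \<sigma> p \<delta>"
proof -
  \<comment> \<open>The optimal threshold for the means \<open>0\<close> and
    \<open>- \<delta>'\<close>, that is, for the narrower gap. Keeping it while the second mean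
    moves out to \<open>- \<delta>\<close> changes only the term of label 1, which grows; the best
    threshold for the wider gap can only do better.\<close>
  let ?t = "- \<delta>' / 2 - \<sigma>\<^sup>2 * ln ((1 - p) / p) / (- \<delta>')"
  have "gaussian_Q ((?t + \<delta>') / \<sigma>) < gaussian_Q ((?t + \<delta>) / \<sigma>)"
    using assms by (intro gaussian_Q_strict_antimono divide_strict_right_mono) auto
  then have "region_accuracy \<sigma> p 0 (- \<delta>') {..?t} < region_accuracy \<sigma> p 0 (- \<delta>) {..?t}"
    unfolding region_accuracy_atMost[OF assms(1)] using assms by simp
  also have "region_accuracy \<sigma> p 0 (- \<delta>') {..?t} = map_accuracy \<sigma> p \<delta>'"
    using accuracy_formula_eq_region_accuracy[of \<sigma> 0 "- \<delta>'" p] assms by (simp add: map_accuracy_def)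
  also have "region_accuracy \<sigma> p 0 (- \<delta>) {..?t} \<le> map_accuracy \<sigma> p \<delta>"
    using region_accuracy_le_map_accuracy[of \<sigma> p 0 "- \<delta>"] assms by simp
  finally show ?thesis .
qed

lemma map_accuracy_strict_antimono:
  assumes "\<sigma> > 0" "0 < p" "p < 1" "\<delta> < \<delta>'" "\<delta>' \<le> 0"
  shows "map_accuracy \<sigma> p \<delta>' < map_accuracy \<sigma> p \<delta>"
proof (cases "\<delta>' = 0")
  case True
  \<comment> \<open>The constant rules give only a weak inequality at 0; an intermediate point makes it strict.\<close>
  have "map_accuracy \<sigma> p \<delta>' \<le> map_accuracy \<sigma> p (\<delta> / 2)"
    using region_accuracy_le_map_accuracy[of \<sigma> p 0 "- \<delta> / 2" UNIV]
      region_accuracy_le_map_accuracy[of \<sigma> p 0 "- \<delta> / 2" "{}"] assms True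
    by (simp add: map_accuracy_def region_accuracy_UNIV region_accuracy_empty)
  also have "\<dots> < map_accuracy \<sigma> p \<delta>"
    using assms True by (intro map_accuracy_strict_antimono_neg) auto
  finally show ?thesis .
next
  case False
  then show ?thesis using map_accuracy_strict_antimono_neg assms by simp
qed

text \<open>For unequal priors the two arguments of \<open>gaussian_Q\<close> diverge in opposite
  directions, and only the term of the likelier label survives. The limit is the value that
  \<open>map_accuracy\<close> takes at 0.\<close>

lemma accuracy_formula_at_left_0:
  assumes "\<sigma> > 0" "0 < p" "p < 1"
  shows "(accuracy_formula \<sigma> p \<longlongrightarrow> max p (1 - p)) (at_left 0)"
proof -
  let ?L = "ln ((1 - p) / p)"
  have small: "((\<lambda>\<delta>. \<delta> / (2 * \<sigma>)) \<longlongrightarrow> 0) (at_left 0)"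
    using assms by (auto intro!: tendsto_eq_intros)
  \<comment> \<open>The multiple of \<open>inverse \<delta>\<close> outweighs the vanishing summand,
    and \<open>inverse \<delta>\<close> tends to minus infinity from the left, so the sign of
    \<open>c\<close> decides.\<close>
  have top: "filterlim (\<lambda>\<delta>. \<delta> / (2 * \<sigma>) + c * inverse \<delta>) at_top (at_left 0)" if "c < 0" for c
    using that filterlim_inverse_at_bot_neg
    by (simp add: filterlim_tendsto_add_at_top[OF small] filterlim_tendsto_neg_mult_at_top_iff[OF tendsto_const])
  have bot: "filterlim (\<lambda>\<delta>. \<delta> / (2 * \<sigma>) + c * inverse \<delta>) at_bot (at_left 0)" if "c > 0" for c
    using that filterlim_inverse_at_bot_neg
    by (simp add: filterlim_tendsto_add_at_bot_iff[OF small] filterlim_tendsto_pos_mult_at_bot_iff[OF tendsto_const])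
  have formula: "accuracy_formula \<sigma> p \<delta> = p * gaussian_Q (\<delta> / (2 * \<sigma>) + (- \<sigma> * ?L) * inverse \<delta>) +
      (1 - p) * gaussian_Q (\<delta> / (2 * \<sigma>) + (\<sigma> * ?L) * inverse \<delta>)" for \<delta>
    by (simp add: accuracy_formula_def divide_inverse[of \<sigma> \<delta>] ac_simps)
  consider "p < 1 / 2" | "p = 1 / 2" | "p > 1 / 2" by linarith
  then show ?thesis
  proof cases
    case 1
    then have L: "- \<sigma> * ?L < 0" "\<sigma> * ?L > 0" using assms by simp_all
    have "((\<lambda>\<delta>. gaussian_Q (\<delta> / (2 * \<sigma>) + (- \<sigma> * ?L) * inverse \<delta>)) \<longlongrightarrow> 0) (at_left 0)"
        "((\<lambda>\<delta>. gaussian_Q (\<delta> / (2 * \<sigma>) + (\<sigma> * ?L) * inverse \<delta>)) \<longlongrightarrow> 1) (at_left 0)"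
      by (rule filterlim_compose[OF gaussian_Q_at_top top[OF L(1)]],
          rule filterlim_compose[OF gaussian_Q_at_bot bot[OF L(2)]])
    then have "(accuracy_formula \<sigma> p \<longlongrightarrow> p * 0 + (1 - p) * 1) (at_left 0)"
      unfolding formula[abs_def] by (intro tendsto_intros)
    then show ?thesis using 1 by (simp add: max_def)
  next
    case 2
    \<comment> \<open>For equal priors the logarithm is 0, both arguments tend to 0, and continuity
      gives the limit.\<close>
    have "gaussian_Q 0 = 1 / 2" using gaussian_Q_minus[of 0] by simp
    moreover have "((\<lambda>\<delta>. gaussian_Q (\<delta> / (2 * \<sigma>))) \<longlongrightarrow> gaussian_Q 0) (at_left 0)"
      using isCont_tendsto_compose[OF isCont_gaussian_Q small] .
    moreover have "accuracy_formula \<sigma> p = (\<lambda>\<delta>. gaussian_Q (\<delta> / (2 * \<sigma>)))"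
      unfolding 2 by (rule ext) (simp add: accuracy_formula_def)
    ultimately have "(accuracy_formula \<sigma> p \<longlongrightarrow> 1 / 2) (at_left 0)" by (simp only:)
    then show ?thesis by (simp add: 2)
  next
    case 3
    then have "?L < 0" using assms by (intro ln_less_zero) auto
    from mult_pos_neg[OF assms(1) this] have L: "\<sigma> * ?L < 0" "- \<sigma> * ?L > 0" by linarith+
    have "((\<lambda>\<delta>. gaussian_Q (\<delta> / (2 * \<sigma>) + (- \<sigma> * ?L) * inverse \<delta>)) \<longlongrightarrow> 1) (at_left 0)"
        "((\<lambda>\<delta>. gaussian_Q (\<delta> / (2 * \<sigma>) + (\<sigma> * ?L) * inverse \<delta>)) \<longlongrightarrow> 0) (at_left 0)"
      by (rule filterlim_compose[OF gaussian_Q_at_bot bot[OF L(2)]],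
          rule filterlim_compose[OF gaussian_Q_at_top top[OF L(1)]])
    then have "(accuracy_formula \<sigma> p \<longlongrightarrow> p * 1 + (1 - p) * 0) (at_left 0)"
      unfolding formula[abs_def] by (intro tendsto_intros)
    then show ?thesis using 3 by (simp add: max_def)
  qed
qed

section \<open>Conditional Gaussian laws and the accuracy on \<open>M\<close>\<close>

text \<open>Given the label, disclosure shifts \<open>X\<close> by a constant
  \<open>\<beta>\<close>, namely \<open>b0\<close> or \<open>- b1\<close>. The joint probability is
  the prior \<open>q\<close> times the conditional one, and the shift moves the mean of the
  conditional law.\<close>

lemma measure_disclosed_given_label:
  assumes M: "prob_space M" and C [measurable]: "C \<in> M \<rightarrow>\<^sub>M count_space {0, 1}"
    and X [measurable]: "X \<in> borel_measurable M"
    and q: "measure M {\<omega> \<in> space M. C \<omega> = c} = q" "q > 0"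
    and d: "distributed (uniform_measure M {\<omega> \<in> space M. C \<omega> = c}) lborel X
           (\<lambda>x. ennreal (normal_density m \<sigma> x))"
    and "\<sigma> > 0" and S: "S \<in> sets borel"
  shows "measure M {\<omega> \<in> space M. C \<omega> = c \<and> X \<omega> + \<beta> \<in> S} = q * measure (normal_dist (m + \<beta>) \<sigma>) S"
proof -
  interpret prob_space M by fact
  let ?A = "{\<omega> \<in> space M. C \<omega> = c}"
  let ?B = "{\<omega> \<in> space M. X \<omega> + \<beta> \<in> S}"
  \<comment> \<open>Conditioning by \<open>uniform_measure\<close> is meaningful because the label
    has positive probability.\<close>
  have A: "emeasure M ?A \<noteq> 0" "emeasure M ?A \<noteq> \<infinity>"
    using q by (auto simp: emeasure_eq_measure)
  have B: "?B \<in> sets M" using S by measurable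
  have "measure (normal_dist (m + \<beta>) \<sigma>) S = measure (normal_dist m \<sigma>) {x. x + \<beta> \<in> S}"
    using measure_normal_dist_affine[of \<sigma> 1 S \<beta> m] assms by (simp add: add.commute)
  also have "normal_dist m \<sigma> = distr (uniform_measure M ?A) lborel X"
    using d by (simp add: distributed_def)
  also have "measure \<dots> {x. x + \<beta> \<in> S} = measure (uniform_measure M ?A) ?B"
    using S by (subst measure_distr) (auto simp: vimage_def Int_def conj_commute)
  also have "\<dots> = measure M (?A \<inter> ?B) / q"
    using measure_uniform_measure[OF A B] q by simp
  finally show ?thesis using q by (simp add: Int_def conj_ac cong: conj_cong)
qed

text \<open>The event of a correct guess splits by label into two disjoint events: \<open>Z\<close>
  falls into the region of guess 0 under label 0, or outside it under label 1.\<close>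

lemma accuracy_disclosed:
  assumes M: "prob_space M" and C [measurable]: "C \<in> M \<rightarrow>\<^sub>M count_space {0, 1}"
    and X [measurable]: "X \<in> borel_measurable M"
    and p: "0 < p" "p < 1" and \<sigma>: "\<sigma> > 0"
    and q: "measure M {\<omega> \<in> space M. C \<omega> = 0} = p" "measure M {\<omega> \<in> space M. C \<omega> = 1} = 1 - p"
    and d0: "distributed (uniform_measure M {\<omega> \<in> space M. C \<omega> = 0}) lborel X
           (\<lambda>x. ennreal (normal_density \<mu>0 \<sigma> x))"
    and d1: "distributed (uniform_measure M {\<omega> \<in> space M. C \<omega> = 1}) lborel X
           (\<lambda>x. ennreal (normal_density \<mu>1 \<sigma> x))"
    and h: "h \<in> borel \<rightarrow>\<^sub>M count_space {0, 1}"
  shows "{x. h x = 0} \<in> sets borel"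
    and "accuracy M C (disclosed C X b0 b1) h = region_accuracy \<sigma> p (\<mu>0 + b0) (\<mu>1 - b1) {x. h x = 0}"
proof -
  interpret prob_space M by fact
  let ?S = "{x. h x = 0}"
  have C01: "C \<omega> = 0 \<or> C \<omega> = 1" if "\<omega> \<in> space M" for \<omega>
    using measurable_space[OF C that] by simp
  have h01: "h x = 0 \<or> h x = 1" for x using measurable_space[OF h, of x] by simp
  have "h -` {0} \<inter> space borel \<in> sets borel" using h by (rule measurable_sets) simp
  then show S: "?S \<in> sets borel" by (simp add: vimage_def)
  have meas: "{\<omega> \<in> space M. C \<omega> = c \<and> X \<omega> + \<beta> \<in> T} \<in> sets M"
    if T [measurable]: "T \<in> sets borel" and "c \<in> {0, 1}" for c T \<beta>
  proof -
    have "C -` {c} \<inter> space M \<in> sets M" using C by (rule measurable_sets) (use that in auto)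
    moreover have "{\<omega> \<in> space M. X \<omega> + \<beta> \<in> T} \<in> sets M" by measurable
    moreover have "{\<omega> \<in> space M. C \<omega> = c \<and> X \<omega> + \<beta> \<in> T} =
        (C -` {c} \<inter> space M) \<inter> {\<omega> \<in> space M. X \<omega> + \<beta> \<in> T}" by auto
    ultimately show ?thesis by simp
  qed
  let ?A = "{\<omega> \<in> space M. C \<omega> = 0 \<and> X \<omega> + b0 \<in> ?S}"
  let ?B = "{\<omega> \<in> space M. C \<omega> = 1 \<and> X \<omega> + (- b1) \<in> - ?S}"
  have "{\<omega> \<in> space M. h (disclosed C X b0 b1 \<omega>) = C \<omega>} = ?A \<union> ?B"
  proof (rule Set.set_eqI)
    fix \<omega>
    show "\<omega> \<in> {\<omega> \<in> space M. h (disclosed C X b0 b1 \<omega>) = C \<omega>} \<longleftrightarrow> \<omega> \<in> ?A \<union> ?B"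
      using C01[of \<omega>] h01[of "X \<omega> + b0"] h01[of "X \<omega> + (- b1)"]
      by (cases "\<omega> \<in> space M"; cases "C \<omega> = 0") (auto simp: disclosed_def)
  qed
  then have "accuracy M C (disclosed C X b0 b1) h = prob ?A + prob ?B"
    unfolding accuracy_def using meas[of ?S 0 b0] meas[of "- ?S" 1 "- b1"] S
    by (auto intro!: finite_measure_Union)
  also have "prob ?A = p * measure (normal_dist (\<mu>0 + b0) \<sigma>) ?S"
    by (rule measure_disclosed_given_label[OF M C X q(1) p(1) d0 \<sigma> S])
  also have "prob ?B = (1 - p) * measure (normal_dist (\<mu>1 + (- b1)) \<sigma>) (- ?S)"
    using S p by (intro measure_disclosed_given_label[OF M C X q(2) _ d1 \<sigma>]) auto
  finally show "accuracy M C (disclosed C X b0 b1) h =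
      region_accuracy \<sigma> p (\<mu>0 + b0) (\<mu>1 - b1) ?S"
    by (simp add: region_accuracy_def)
qed

text \<open>The upper bound holds for the decision region of any rule. Conversely, the bound is
  attained by some region, and a MAP rule is at least as accurate as the rule with that region,
  however it breaks ties.\<close>

lemma MAP_rule_accuracy:
  assumes M: "prob_space M" and C: "C \<in> M \<rightarrow>\<^sub>M count_space {0, 1}"
    and X: "X \<in> borel_measurable M"
    and p: "0 < p" "p < 1" and \<sigma>: "\<sigma> > 0"
    and q: "measure M {\<omega> \<in> space M. C \<omega> = 0} = p" "measure M {\<omega> \<in> space M. C \<omega> = 1} = 1 - p"
    and d0: "distributed (uniform_measure M {\<omega> \<in> space M. C \<omega> = 0}) lborel X
           (\<lambda>x. ennreal (normal_density \<mu>0 \<sigma> x))"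
    and d1: "distributed (uniform_measure M {\<omega> \<in> space M. C \<omega> = 1}) lborel X
           (\<lambda>x. ennreal (normal_density \<mu>1 \<sigma> x))"
    and le: "\<mu>0 + b0 \<le> \<mu>1 - b1"
    and g: "MAP_rule M C (disclosed C X b0 b1) g"
  shows "accuracy M C (disclosed C X b0 b1) g = map_accuracy \<sigma> p ((\<mu>0 + b0) - (\<mu>1 - b1))"
proof (rule antisym)
  let ?Z = "disclosed C X b0 b1"
  note acc = accuracy_disclosed[OF M C X p \<sigma> q d0 d1]
  have g': "g \<in> borel \<rightarrow>\<^sub>M count_space {0, 1}" using g by (simp add: MAP_rule_def)
  show "accuracy M C ?Z g \<le> map_accuracy \<sigma> p ((\<mu>0 + b0) - (\<mu>1 - b1))"
    unfolding acc(2)[OF g'] by (rule region_accuracy_le_map_accuracy[OF \<sigma> p le acc(1)[OF g']])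
  obtain S where S: "S \<in> sets borel"
    and S_eq: "region_accuracy \<sigma> p (\<mu>0 + b0) (\<mu>1 - b1) S = map_accuracy \<sigma> p ((\<mu>0 + b0) - (\<mu>1 - b1))"
    using map_accuracy_attained[OF \<sigma> le] by blast
  define h where "h x = (if x \<in> S then 0 else 1 :: nat)" for x
  have hS: "{x. h x = 0} = S" by (auto simp: h_def)
  have h: "h \<in> borel \<rightarrow>\<^sub>M count_space {0, 1}"
    unfolding h_def[abs_def] using S by (intro measurable_If_set) auto
  have "(\<lambda>\<omega>. real (C \<omega>)) \<in> borel_measurable M"
    using C by (rule measurable_compose) simp
  then have "?Z \<in> borel_measurable M"
    unfolding disclosed_def[abs_def] using X by measurable
  from MAP_rule_maximizes_accuracy[OF M C this g h]
  show "map_accuracy \<sigma> p ((\<mu>0 + b0) - (\<mu>1 - b1)) \<le> accuracy M C ?Z g"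
    unfolding acc(2)[OF h] using S_eq hS by simp
qed

section \<open>The distortion constraint and the sum of the parameters\<close>

text \<open>The Cauchy-Schwarz inequality for \<open>b0 + b1\<close>, with its remainder.\<close>

lemma distortion_eq:
  "(1 - p) * b0\<^sup>2 + p * b1\<^sup>2 = p * (1 - p) * (b0 + b1)\<^sup>2 + ((1 - p) * b0 - p * b1)\<^sup>2" for p :: real
  by (simp add: power2_eq_square algebra_simps)

text \<open>These pairs, with sum \<open>s\<close>, are the equality case: the remainder in
  \<open>distortion_eq\<close> vanishes.\<close>

lemma scaled_pair_in_distortion_set_iff:
  assumes "0 < p" "p < 1" "0 \<le> s"
  shows "(s * p, s * (1 - p)) \<in> distortion_set p D \<longleftrightarrow> p * (1 - p) * s\<^sup>2 \<le> D"
proof -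
  have "s * p + s * (1 - p) = s" "(1 - p) * (s * p) - p * (s * (1 - p)) = 0"
    by (simp_all add: algebra_simps)
  then show ?thesis using assms by (simp add: distortion_set_def distortion_eq)
qed

text \<open>Dropping the remainder square bounds the sum. If the bound is attained, that square must
  be 0, which fixes the ratio of \<open>b0\<close> to \<open>b1\<close>.\<close>

lemma distortion_set_sum_le:
  assumes "0 < p" "p < 1" "0 \<le> s" "p * (1 - p) * s\<^sup>2 = D" "(b0, b1) \<in> distortion_set p D"
  shows "b0 + b1 \<le> s" and "b0 + b1 = s \<Longrightarrow> b0 = s * p \<and> b1 = s * (1 - p)"
proof -
  have *: "p * (1 - p) * (b0 + b1)\<^sup>2 + ((1 - p) * b0 - p * b1)\<^sup>2 \<le> p * (1 - p) * s\<^sup>2"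
    using assms by (simp add: distortion_set_def distortion_eq)
  then have "p * (1 - p) * (b0 + b1)\<^sup>2 \<le> p * (1 - p) * s\<^sup>2"
    using zero_le_power2[of "(1 - p) * b0 - p * b1"] by linarith
  moreover have "p * (1 - p) > 0" using assms(1,2) by simp
  ultimately have "(b0 + b1)\<^sup>2 \<le> s\<^sup>2" by (simp only: mult_le_cancel_left_pos)
  then show "b0 + b1 \<le> s" using assms(3) by (rule power2_le_imp_le)
  assume s: "b0 + b1 = s"
  from * have "((1 - p) * b0 - p * b1)\<^sup>2 \<le> 0" unfolding s by simp
  then have "(1 - p) * b0 = p * b1" by simp
  then show "b0 = s * p \<and> b1 = s * (1 - p)" unfolding s[symmetric] by (simp add: algebra_simps)
qed

text \<open>Here \<open>s\<close> is the largest sum \<open>b0 + b1\<close> that distortion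
  \<open>D\<close> permits, and the solution is the equality pair with this sum.\<close>

lemma small_D_solution_eq:
  assumes "0 < p" "p < 1" "D \<ge> 0"
  defines "s \<equiv> sqrt (D / (p * (1 - p)))"
  shows "small_D_solution p D = (s * p, s * (1 - p))" "p * (1 - p) * s\<^sup>2 = D" "s \<ge> 0"
proof -
  have "s * p = sqrt (D / (p * (1 - p)) * p\<^sup>2)" "s * (1 - p) = sqrt (D / (p * (1 - p)) * (1 - p)\<^sup>2)"
    using assms by (simp_all only: s_def real_sqrt_mult real_sqrt_abs)
  moreover have "D / (p * (1 - p)) * p\<^sup>2 = p / (1 - p) * D"
    "D / (p * (1 - p)) * (1 - p)\<^sup>2 = (1 - p) / p * D"
    using assms by (simp_all add: power2_eq_square)
  ultimately show "small_D_solution p D = (s * p, s * (1 - p))"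
    by (simp add: small_D_solution_def)
  show "p * (1 - p) * s\<^sup>2 = D" "s \<ge> 0" using assms by (simp_all add: s_def)
qed

section \<open>Minimisers of the accuracy over the admissible pairs\<close>

theorem mainTheorem2:
  fixes M :: "'a measure" and C :: "'a \<Rightarrow> nat" and X :: "'a \<Rightarrow> real"
    and \<mu>0 \<mu>1 \<sigma> p D :: real
    and g :: "real \<Rightarrow> real \<Rightarrow> real \<Rightarrow> nat"
  assumes "\<mu>0 \<le> \<mu>1" and "\<sigma> > 0" and "0 < p" and "p < 1" and "D \<ge> 0"
    and "prob_space M"
    and "C \<in> M \<rightarrow>\<^sub>M count_space {0, 1}"
    and "X \<in> borel_measurable M"
    and "measure M {\<omega> \<in> space M. C \<omega> = 0} = p"
    and "measure M {\<omega> \<in> space M. C \<omega> = 1} = 1 - p"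
    and "distributed (uniform_measure M {\<omega> \<in> space M. C \<omega> = 0}) lborel X
           (\<lambda>x. ennreal (normal_density \<mu>0 \<sigma> x))"
    and "distributed (uniform_measure M {\<omega> \<in> space M. C \<omega> = 1}) lborel X
           (\<lambda>x. ennreal (normal_density \<mu>1 \<sigma> x))"
    and "\<And>b0 b1. (b0, b1) \<in> admissible \<mu>0 \<mu>1 p D \<Longrightarrow>
           MAP_rule M C (disclosed C X b0 b1) (g b0 b1)"
  defines "acc \<equiv> \<lambda>(b0, b1). accuracy M C (disclosed C X b0 b1) (g b0 b1)"
  defines "optimal \<equiv> is_arg_min acc (\<lambda>b. b \<in> admissible \<mu>0 \<mu>1 p D)"
  shows "(\<forall>b0 b1. optimal (b0, b1) \<longrightarrow>
            (let \<delta> = (\<mu>0 + b0) - (\<mu>1 - b1) in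
               (\<delta> \<noteq> 0 \<longrightarrow> acc (b0, b1) = accuracy_formula \<sigma> p \<delta>) \<and>
               (\<delta> = 0 \<longrightarrow> (accuracy_formula \<sigma> p \<longlongrightarrow> acc (b0, b1)) (at_left 0))))
       \<and> (D \<le> p * (1 - p) * (\<mu>1 - \<mu>0)\<^sup>2 \<longrightarrow>
            (\<forall>b. optimal b \<longleftrightarrow> b = small_D_solution p D))
       \<and> (\<not> D \<le> p * (1 - p) * (\<mu>1 - \<mu>0)\<^sup>2 \<longrightarrow>
            optimal (large_D_solution \<mu>0 \<mu>1 p) \<and>
            (optimal (large_D_solution_source \<mu>0 \<mu>1 p) \<longleftrightarrow>
               large_D_solution_source \<mu>0 \<mu>1 p \<in> distortion_set p D))"
proof -
  let ?A = "admissible \<mu>0 \<mu>1 p D"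
  define \<Delta> where "\<Delta> = \<mu>1 - \<mu>0"
  have \<Delta>: "\<Delta> \<ge> 0" using assms(1) by (simp add: \<Delta>_def)
  \<comment> \<open>The order of the means is itself a bound on the sum, so both the constraint and
    the objective can be read off \<open>b0 + b1\<close>.\<close>
  have A: "(b0, b1) \<in> ?A \<longleftrightarrow> (b0, b1) \<in> distortion_set p D \<and> b0 + b1 \<le> \<Delta>" for b0 b1
    by (auto simp: admissible_def \<Delta>_def)
  have acc: "acc (b0, b1) = map_accuracy \<sigma> p ((\<mu>0 + b0) - (\<mu>1 - b1))" if "(b0, b1) \<in> ?A" for b0 b1
    unfolding acc_def prod.case
    using that assms(13)[OF that] by (intro MAP_rule_accuracy[OF assms(6-8,3,4,2,9-12)]) (auto simp: A \<Delta>_def)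
  \<comment> \<open>As an equivalence, this identifies minimisers of the accuracy with maximisers of
    the sum.\<close>
  have less_iff: "acc (b0, b1) < acc (c0, c1) \<longleftrightarrow> c0 + c1 < b0 + b1"
    if b: "(b0, b1) \<in> ?A" and c: "(c0, c1) \<in> ?A" for b0 b1 c0 c1
  proof -
    have *: "acc (x0, x1) = map_accuracy \<sigma> p ((x0 + x1) - \<Delta>)" if "(x0, x1) \<in> ?A" for x0 x1
      unfolding acc[OF that] by (rule arg_cong[where f="map_accuracy \<sigma> p"]) (simp add: \<Delta>_def)
    have le: "b0 + b1 \<le> \<Delta>" "c0 + c1 \<le> \<Delta>" using b c by (auto simp: A)
    consider "c0 + c1 < b0 + b1" | "c0 + c1 = b0 + b1" | "b0 + b1 < c0 + c1" by linarith
    then show ?thesis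
    proof cases
      case 1
      then show ?thesis unfolding *[OF b] *[OF c]
        using map_accuracy_strict_antimono[OF assms(2-4), of "c0 + c1 - \<Delta>" "b0 + b1 - \<Delta>"] le by simp
    next
      case 2
      then show ?thesis unfolding *[OF b] *[OF c] by simp
    next
      case 3
      then show ?thesis unfolding *[OF b] *[OF c]
        using map_accuracy_strict_antimono[OF assms(2-4), of "b0 + b1 - \<Delta>" "c0 + c1 - \<Delta>"] le by simp
    qed
  qed
  have optimal: "optimal (b0, b1) \<longleftrightarrow>
      (b0, b1) \<in> ?A \<and> (\<forall>c0 c1. (c0, c1) \<in> ?A \<longrightarrow> c0 + c1 \<le> b0 + b1)" for b0 b1
    unfolding optimal_def is_arg_min_def split_paired_All split_paired_Ex
    using less_iff by (meson not_less)
  \<comment> \<open>A pair with sum \<open>\<Delta>\<close> makes the two means coincide, and no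
    admissible pair has a larger sum; only the distortion bound remains to be checked.\<close>
  have full: "optimal (b0, b1) \<longleftrightarrow> (b0, b1) \<in> distortion_set p D" if "b0 + b1 = \<Delta>" for b0 b1
    using that by (auto simp: optimal A)
  have accuracy_at_optimum: "(\<delta> \<noteq> 0 \<longrightarrow> acc (b0, b1) = accuracy_formula \<sigma> p \<delta>) \<and>
      (\<delta> = 0 \<longrightarrow> (accuracy_formula \<sigma> p \<longlongrightarrow> acc (b0, b1)) (at_left 0))"
    if "optimal (b0, b1)" and \<delta>: "\<delta> = (\<mu>0 + b0) - (\<mu>1 - b1)" for b0 b1 \<delta>
  proof -
    have "acc (b0, b1) = map_accuracy \<sigma> p \<delta>" using that acc by (simp add: optimal)
    then show ?thesis
      using accuracy_formula_at_left_0[OF assms(2-4)] by (simp add: map_accuracy_def)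
  qed
  have small: "optimal (b0, b1) \<longleftrightarrow> (b0, b1) = small_D_solution p D"
    if D: "D \<le> p * (1 - p) * (\<mu>1 - \<mu>0)\<^sup>2" for b0 b1
  proof -
    define s where "s = sqrt (D / (p * (1 - p)))"
    note s = small_D_solution_eq[OF assms(3-5), folded s_def]
    have sum: "s * p + s * (1 - p) = s" by (simp add: algebra_simps)
    \<comment> \<open>The hypothesis on \<open>D\<close> amounts to \<open>s \<le> \<Delta>\<close>:
      the distortion bound is reached no later than the means meet.\<close>
    have "p * (1 - p) * s\<^sup>2 \<le> p * (1 - p) * \<Delta>\<^sup>2" using D s(2) by (simp add: \<Delta>_def)
    moreover have "p * (1 - p) > 0" using assms(3,4) by simp
    ultimately have "s\<^sup>2 \<le> \<Delta>\<^sup>2" by (simp only: mult_le_cancel_left_pos)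
    then have "s \<le> \<Delta>" using \<Delta> by (rule power2_le_imp_le)
    then have sA: "(s * p, s * (1 - p)) \<in> ?A"
      using s scaled_pair_in_distortion_set_iff[OF assms(3,4) s(3), of D] \<open>s \<le> \<Delta>\<close> by (simp add: A sum)
    note bound = distortion_set_sum_le[OF assms(3,4) s(3,2)]
    have "optimal (b0, b1) \<longleftrightarrow> b0 = s * p \<and> b1 = s * (1 - p)"
    proof
      assume opt: "optimal (b0, b1)"
      \<comment> \<open>Comparison with the equality pair gives one inequality and
        \<open>bound\<close> the other; equality of the sums then determines both entries.\<close>
      then have "s \<le> b0 + b1" using sA sum by (metis optimal)
      with opt show "b0 = s * p \<and> b1 = s * (1 - p)"
        using bound[of b0 b1] by (simp add: optimal A)
    next
      assume "b0 = s * p \<and> b1 = s * (1 - p)"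
      then show "optimal (b0, b1)" using sA sum bound(1) by (simp add: optimal A)
    qed
    then show ?thesis by (simp add: s(1))
  qed
  have large: "optimal (large_D_solution \<mu>0 \<mu>1 p)" if "\<not> D \<le> p * (1 - p) * (\<mu>1 - \<mu>0)\<^sup>2"
  proof -
    have "\<Delta> * p + \<Delta> * (1 - p) = \<Delta>" by (simp add: algebra_simps)
    \<comment> \<open>The equality pair with sum \<open>\<Delta>\<close> has the least distortion
      for that sum, and it stays below \<open>D\<close> in this case.\<close>
    moreover have "(\<Delta> * p, \<Delta> * (1 - p)) \<in> distortion_set p D"
      using that by (subst scaled_pair_in_distortion_set_iff[OF assms(3,4) \<Delta>]) (simp add: \<Delta>_def)
    ultimately show ?thesis unfolding large_D_solution_def by (simp add: full flip: \<Delta>_def)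
  qed
  \<comment> \<open>Exchanging the factors leaves the sum \<open>\<Delta>\<close> unchanged, so
    \<open>full\<close> applies to this pair too.\<close>
  have source: "optimal (large_D_solution_source \<mu>0 \<mu>1 p) \<longleftrightarrow>
      large_D_solution_source \<mu>0 \<mu>1 p \<in> distortion_set p D"
    unfolding large_D_solution_source_def by (rule full) (simp add: \<Delta>_def algebra_simps)
  show ?thesis using accuracy_at_optimum small large source by (simp add: Let_def split_paired_all)
qed

end
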